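(* Let $S_t=S_0e^{X_t}$ where $(X_t)$ is a real Lévy process with triplet $(\sigma^2,b,\nu)$ satisfying the standing assumptions in the context, and let $\nu^*(x)=e^x\nu(x)$, $b^*=b+\int_{|x|\le1}x(e^x-1)\nu(x)\,dx+\sigma^2$. For $k>0$ set $$a_1(k;b,\sigma,\nu):=\frac12\big[d_2(k;b^*,\sigma,\nu^* )-e^k d_2(k;b,\sigma,\nu)\big].$$ Then: (1) If $X$ is of bounded variation ($\sigma=0$ and $\int_{|x|\le1}|x|\nu(dx)<\infty$), then the drifts $b_0:=b-\int_{|x|\le1}x\nu(x)\,dx$ and $b_0^*:=b^*-\int_{|x|\le1}x\nu^*(x)\,dx$ coincide. (2) $a_1(k;b,\sigma,\nu)$ does not depend on $b$; writing $R(y;\nu):=d_2(y;b,\sigma,\nu)-(-\sigma^2\nu'(y)+2b\nu(y))$ (which depends only on $y$ and $\nu$), $$a_1(k;b,\sigma,\nu)=\frac{\sigma^2}{2}e^k\nu(k)+e^k\nu(k)\int_{|x|\le1}x(e^x-1)\nu(x)\,dx+\frac12\big[R(k;\nu^* )-e^kR(k;\nu)\big].$$ (3) Consequently $$a_1(k;b,\sigma,\nu)-a_1(k;b,0,\nu)=\frac{\sigma^2}{2}e^k\nu(k),$$ i.e. a non-zero $\sigma$ increases the second-order call price approximation $S_0\big(t\int(e^x-e^k)_+\nu(x)\,dx+t^2a_1(k)\big)$ by $\frac{\sigma^2t^2}{2}e^k\nu(k)$ per unit of $S_0$.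
   Context: Triplet convention: $\mathbb{E}e^{iuX_t}=\exp\{t(ibu-\tfrac12\sigma^2u^2+\int(e^{iux}-1-iux1_{|x|\le1})\nu(dx))\}$. Standing assumptions: $\int_{|x|>1}e^x\nu(dx)<\infty$; the martingale condition $b+\tfrac12\sigma^2+\int(e^x-1-x1_{|x|\le1})\nu(dx)=0$ holds for the model; $\nu(dx)$ has a positive density $\nu(x)$, $C^1$ on $\mathbb{R}\setminus\{0\}$, with $\sup_{|x|>\varepsilon}\nu(x)<\infty$ and $\sup_{|x|>\varepsilon}e^x\nu(x)<\infty$ for every $\varepsilon>0$. In (2) and (3), $a_1(k;b,\sigma,\nu)$ is regarded as a function of its arguments $b,\sigma$ through the displayed formulas ($b^*$ being the function of $(b,\sigma,\nu)$ above). Definition of $d_2$: for $y>0$, $$\begin{aligned} d_2(y;b,\sigma,\nu)=&-\sigma^2\nu'(y)+2b\,\nu(y)-\nu[y,\infty)^2+\nu(\tfrac12y,y)^2+2\int_{-\infty}^{-y/2}\int_{y-x}^{y}\nu(u)\nu(x)\,du\,dx\\&-2\nu(y)\,I(y)+2\int_{-y/2}^{y/2}\int_{y-x}^{y}(\nu(u)-\nu(y))\nu(x)\,du\,dx,\end{aligned}$$ where $\nu[y,\infty)$ and $\nu(\tfrac12 y,y)$ denote the $\nu$-measures of these intervals, inner integrals are oriented ($\int_{y-x}^y=-\int_y^{y-x}$ when $x<0$), and $I(y)=\int_{y/2<|x|\le1}x\nu(x)\,dx$ if $y\le2$, $I(y)=-\int_{1<|x|\le y/2}x\nu(x)\,dx$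 if $y>2$. *)

theory Defs
  imports "HOL-Probability.Probability"
begin

definition cadlag :: "(real \<Rightarrow> real) \<Rightarrow> bool" where
  "cadlag f \<longleftrightarrow>
     (\<forall>t\<ge>0. (f \<longlongrightarrow> f t) (at_right t)) \<and>
     (\<forall>t>0. \<exists>l. (f \<longlongrightarrow> l) (at_left t))"

text \<open>The time set is the half-line \<open>t \<ge> 0\<close>; values of \<open>X\<close> at negative times are irrelevant.\<close>

definition levy_process :: "'a measure \<Rightarrow> (real \<Rightarrow> 'a \<Rightarrow> real) \<Rightarrow> bool" where
  "levy_process M X \<longleftrightarrow>
     prob_space M \<and>
     (\<forall>t\<ge>0. X t \<in> borel_measurable M) \<and>
     (AE \<omega> in M. X 0 \<omega> = 0) \<and>
     (\<forall>n (\<tau> :: nat \<Rightarrow> real). 0 \<le> \<tau> 0 \<and> mono \<tau> \<longrightarrow>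
        prob_space.indep_vars M (\<lambda>_. borel) (\<lambda>i \<omega>. X (\<tau> (Suc i)) \<omega> - X (\<tau> i) \<omega>) {..<n}) \<and>
     (\<forall>s\<ge>0. \<forall>h\<ge>0. distr M borel (\<lambda>\<omega>. X (s + h) \<omega> - X s \<omega>) = distr M borel (X h)) \<and>
     (\<forall>t\<ge>0. \<forall>\<epsilon>>0.
        ((\<lambda>s. measure M {\<omega> \<in> space M. \<bar>X s \<omega> - X t \<omega>\<bar> > \<epsilon>}) \<longlongrightarrow> 0) (at t within {0..})) \<and>
     (AE \<omega> in M. cadlag (\<lambda>t. X t \<omega>))"

definition levy_measure :: "real measure \<Rightarrow> bool" where
  "levy_measure N \<longleftrightarrow>
     sets N = sets borel \<and> emeasure N {0} = 0 \<and> (\<integral>\<^sup>+x. ennreal (min 1 (x\<^sup>2)) \<partial>N) < \<infinity>"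

text \<open>The triplet is listed as (Gaussian variance, drift, Levy measure), the drift being
  relative to the truncation function \<open>x * indicator {-1..1} x\<close>.\<close>

definition has_levy_triplet ::
  "'a measure \<Rightarrow> (real \<Rightarrow> 'a \<Rightarrow> real) \<Rightarrow> real \<Rightarrow> real \<Rightarrow> real measure \<Rightarrow> bool" where
  "has_levy_triplet M X v b N \<longleftrightarrow>
     levy_measure N \<and>
     (\<forall>t\<ge>0. \<forall>u. char (distr M borel (X t)) u =
        exp (complex_of_real t *
          (\<i> * complex_of_real (b * u) - complex_of_real (v * u\<^sup>2 / 2)
           + (CLINT x|N. iexp (u * x) - 1 - \<i> * complex_of_real (u * x * indicator {-1..1} x)))))"

definition jump_measure :: "(real \<Rightarrow> real) \<Rightarrow> real measure" where
  "jump_measure \<nu> = density lborel (\<lambda>x. ennreal (\<nu> x))"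

definition nu_star :: "(real \<Rightarrow> real) \<Rightarrow> real \<Rightarrow> real" where
  "nu_star \<nu> x = exp x * \<nu> x"

definition b_star :: "real \<Rightarrow> real \<Rightarrow> (real \<Rightarrow> real) \<Rightarrow> real" where
  "b_star b \<sigma> \<nu> = b + (LBINT x:{-1..1}. x * (exp x - 1) * \<nu> x) + \<sigma>\<^sup>2"

definition I_term :: "real \<Rightarrow> (real \<Rightarrow> real) \<Rightarrow> real" where
  "I_term y \<nu> =
     (if y \<le> 2 then (LBINT x:{x. y / 2 < \<bar>x\<bar> \<and> \<bar>x\<bar> \<le> 1}. x * \<nu> x)
      else - (LBINT x:{x. 1 < \<bar>x\<bar> \<and> \<bar>x\<bar> \<le> y / 2}. x * \<nu> x))"

text \<open>The interval integrals are oriented: \<open>LBINT u=a..b. f u\<close> is minus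
  \<open>LBINT u=b..a. f u\<close> for \<open>b < a\<close>.\<close>

definition d2 :: "real \<Rightarrow> real \<Rightarrow> real \<Rightarrow> (real \<Rightarrow> real) \<Rightarrow> real" where
  "d2 y b \<sigma> \<nu> =
     - \<sigma>\<^sup>2 * deriv \<nu> y + 2 * b * \<nu> y
     - (measure (jump_measure \<nu>) {y..})\<^sup>2
     + (measure (jump_measure \<nu>) {y / 2<..<y})\<^sup>2
     + 2 * (LBINT x=-\<infinity>..ereal (- y / 2). (LBINT u=ereal (y - x)..ereal y. \<nu> u * \<nu> x))
     - 2 * \<nu> y * I_term y \<nu>
     + 2 * (LBINT x=ereal (- y / 2)..ereal (y / 2).
              (LBINT u=ereal (y - x)..ereal y. (\<nu> u - \<nu> y) * \<nu> x))"

definition a1 :: "real \<Rightarrow> real \<Rightarrow> real \<Rightarrow> (real \<Rightarrow> real) \<Rightarrow> real" where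
  "a1 k b \<sigma> \<nu> =
     (1 / 2) * (d2 k (b_star b \<sigma> \<nu>) \<sigma> (nu_star \<nu>) - exp k * d2 k b \<sigma> \<nu>)"

definition call_approx :: "real \<Rightarrow> real \<Rightarrow> real \<Rightarrow> real \<Rightarrow> real \<Rightarrow> (real \<Rightarrow> real) \<Rightarrow> real" where
  "call_approx S0 t k b \<sigma> \<nu> =
     S0 * (t * (LBINT x. max 0 (exp x - exp k) * \<nu> x) + t\<^sup>2 * a1 k b \<sigma> \<nu>)"

end

theory Submission
  imports Defs
begin

text \<open>Split the domain into the Borel sets \<open>- {c}\<close> and \<open>{c}\<close>:
  \<open>f\<close> is continuous on the first and constant on the second, and gluing over a Borel
  partition preserves measurability.\<close>

lemma continuous_on_Compl_singleton_imp_borel_measurable: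
  fixes f :: "'a::t1_space \<Rightarrow> 'b::{second_countable_topology,t2_space}"
  assumes "continuous_on (- {c}) f"
  shows "f \<in> borel_measurable borel"
proof (rule measurable_discrete_difference)
  show "(\<lambda>x. if x \<in> - {c} then f x else f c) \<in> borel_measurable borel"
    using assms by (intro borel_measurable_continuous_on_if) auto
qed auto

text \<open>Provides measurability of the Levy density, whose behaviour at 0 is left open.\<close>

lemma C1_differentiable_on_borel_measurable:
  fixes f :: "real \<Rightarrow> real"
  assumes "f C1_differentiable_on (- {0})"
  shows "f \<in> borel_measurable borel"
  using assms
  by (intro continuous_on_Compl_singleton_imp_borel_measurable C1_differentiable_imp_continuous_on)

text \<open>\<open>b\<close> and \<sigma> occur only in the first two summands of \<open>d2\<close>;
  the others see only \<open>y\<close> and \<nu>, so \<open>d2 y 0 0 \<nu>\<close> is exactly the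
  remainder \<open>R\<close> of the theorem.\<close>

lemma d2_affine: "d2 y b \<sigma> \<nu> = - \<sigma>\<^sup>2 * deriv \<nu> y + 2 * b * \<nu> y + d2 y 0 0 \<nu>"
  by (simp add: d2_def)

lemma deriv_nu_star:
  assumes "\<nu> differentiable at x"
  shows "deriv (nu_star \<nu>) x = exp x * \<nu> x + exp x * deriv \<nu> x"
proof -
  have "(\<nu> has_real_derivative deriv \<nu> x) (at x)"
    using assms by (simp add: DERIV_deriv_iff_real_differentiable)
  then have "((\<lambda>x. exp x * \<nu> x) has_real_derivative exp x * \<nu> x + exp x * deriv \<nu> x) (at x)"
    by (auto intro!: derivative_eq_intros)
  then show ?thesis
    unfolding nu_star_def[abs_def] by (rule DERIV_imp_deriv)
qed

text \<open>Differentiating \<open>exp x * \<nu> x\<close> contributes \<open>- \<sigma>\<^sup>2 * exp k * \<nu> k\<close>, while the shift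
  \<open>\<sigma>\<^sup>2\<close> of the drift contributes twice that amount with the opposite sign; every other
  occurrence of \<open>\<sigma>\<close> and \<open>b\<close> cancels.\<close>

lemma a1_eq:
  assumes "\<nu> differentiable at k"
  shows "a1 k b \<sigma> \<nu> = \<sigma>\<^sup>2 / 2 * exp k * \<nu> k
      + exp k * \<nu> k * (LBINT x:{-1..1}. x * (exp x - 1) * \<nu> x)
      + (1 / 2) * (d2 k 0 0 (nu_star \<nu>) - exp k * d2 k 0 0 \<nu>)"
proof -
  have star: "nu_star \<nu> k = exp k * \<nu> k"
    by (simp add: nu_star_def)
  \<comment> \<open>\<open>J\<close> is the jump part of the drift shift from \<open>b\<close> to
    \<open>b_star b \<sigma> \<nu>\<close>; it survives as the middle term of the claim.\<close>
  define J where "J = (LBINT x:{-1..1}. x * (exp x - 1) * \<nu> x)"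
  have "d2 k (b_star b \<sigma> \<nu>) \<sigma> (nu_star \<nu>)
      = - \<sigma>\<^sup>2 * (exp k * \<nu> k + exp k * deriv \<nu> k)
        + 2 * (b + J + \<sigma>\<^sup>2) * (exp k * \<nu> k) + d2 k 0 0 (nu_star \<nu>)"
    unfolding J_def b_star_def[symmetric]
    using d2_affine[of k "b_star b \<sigma> \<nu>" \<sigma> "nu_star \<nu>"]
    by (simp only: deriv_nu_star[OF assms] star)
  then show ?thesis
    unfolding a1_def d2_affine[of k b \<sigma> \<nu>] J_def[symmetric]
    by (simp add: field_simps)
qed

text \<open>For \<sigma> = 0 the drift shift is the integral of
  \<open>x * nu_star \<nu> x - x * \<nu> x\<close> over \<open>{-1..1}\<close>. Bounded variation
  makes both parts integrable, so it is the difference of the two compensators.\<close>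

lemma drift_coincide:
  assumes meas: "\<nu> \<in> borel_measurable borel"
    and pos: "\<And>x. x \<noteq> 0 \<Longrightarrow> \<nu> x \<ge> 0"
    and fin: "(\<integral>\<^sup>+x\<in>{-1..1}. ennreal \<bar>x\<bar> \<partial>jump_measure \<nu>) < \<infinity>"
  shows "b - (LBINT x:{-1..1}. x * \<nu> x)
    = b_star b 0 \<nu> - (LBINT x:{-1..1}. x * nu_star \<nu> x)"
proof -
  note [measurable] = meas
  \<comment> \<open>At \<open>x = 0\<close> the sign of \<open>\<nu> x\<close> is unknown, but the
    factor \<open>x\<close> makes both sides vanish.\<close>
  have norm_eq: "ennreal (norm (indicator {-1..1} x *\<^sub>R (x * \<nu> x)))
      = ennreal (\<nu> x) * (ennreal \<bar>x\<bar> * indicator {-1..1} x)" for x :: real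
    using pos[of x]
    by (cases "x = 0") (auto simp: indicator_def abs_mult mult.commute ennreal_mult')
  have "(\<integral>\<^sup>+x. ennreal (norm (indicator {-1..1} x *\<^sub>R (x * \<nu> x))) \<partial>lborel) < \<infinity>"
    using fin unfolding norm_eq jump_measure_def by (simp add: nn_integral_density)
  then have int: "set_integrable lborel {-1..1} (\<lambda>x. x * \<nu> x)"
    unfolding set_integrable_def by (intro integrableI_bounded) auto
  have int_star: "set_integrable lborel {-1..1} (\<lambda>x. x * nu_star \<nu> x)"
  proof (rule set_integrable_bound)
    \<comment> \<open>The constant is the maximum of \<open>exp\<close> on
      \<open>{-1..1}\<close>.\<close>
    show "set_integrable lborel {-1..1} (\<lambda>x. exp 1 * (x * \<nu> x))"
      using int by simp
    show "set_borel_measurable lborel {-1..1} (\<lambda>x. x * nu_star \<nu> x)"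
      unfolding set_borel_measurable_def nu_star_def by measurable
    show "AE x in lborel. x \<in> {-1..1} \<longrightarrow>
        norm (x * nu_star \<nu> x) \<le> norm (exp 1 * (x * \<nu> x))"
    proof (intro AE_I2 impI)
      fix x :: real
      assume "x \<in> {-1..1}"
      then have "exp x * (\<bar>x\<bar> * \<bar>\<nu> x\<bar>) \<le> exp 1 * (\<bar>x\<bar> * \<bar>\<nu> x\<bar>)"
        by (intro mult_right_mono) auto
      then show "norm (x * nu_star \<nu> x) \<le> norm (exp 1 * (x * \<nu> x))"
        by (simp add: nu_star_def abs_mult mult.left_commute)
    qed
  qed
  have "(LBINT x:{-1..1}. x * (exp x - 1) * \<nu> x)
      = (LBINT x:{-1..1}. x * nu_star \<nu> x - x * \<nu> x)"
    by (simp add: nu_star_def algebra_simps)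
  also have "\<dots> = (LBINT x:{-1..1}. x * nu_star \<nu> x) - (LBINT x:{-1..1}. x * \<nu> x)"
    \<comment> \<open>Both integrability facts enter here: without them the split could fail, since
      a divergent integral has the default value 0.\<close>
    by (rule set_integral_diff(2)[OF int_star int])
  finally show ?thesis
    by (simp add: b_star_def)
qed

text \<open>\<open>a1\<close> is a function of its drift and volatility arguments, so these are
  quantified as \<open>b'\<close> and \<open>s\<close>, apart from the model's own \<open>b\<close>
  and \<sigma>, which the martingale condition ties together. Choosing \<open>R\<close> before
  \<open>b'\<close> and \<open>s\<close> expresses that it depends on \<open>y\<close> and the
  density alone.\<close>

theorem mainTheorem2:
  fixes M :: "'a measure" and X S :: "real \<Rightarrow> 'a \<Rightarrow> real"
    and S0 b \<sigma> :: real and \<nu> :: "real \<Rightarrow> real"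
  assumes levy: "levy_process M X"
    and triplet: "has_levy_triplet M X (\<sigma>\<^sup>2) b (jump_measure \<nu>)"
    and S0_pos: "S0 > 0"
    and price: "\<And>t \<omega>. t \<ge> 0 \<Longrightarrow> \<omega> \<in> space M \<Longrightarrow> S t \<omega> = S0 * exp (X t \<omega>)"
    and exp_moment: "(\<integral>\<^sup>+x\<in>{x. \<bar>x\<bar> > 1}. ennreal (exp x) \<partial>jump_measure \<nu>) < \<infinity>"
    and martingale: "b + \<sigma>\<^sup>2 / 2
        + (LINT x|jump_measure \<nu>. exp x - 1 - x * indicator {-1..1} x) = 0"
    and density_pos: "\<And>x. x \<noteq> 0 \<Longrightarrow> \<nu> x > 0"
    and density_C1: "\<nu> C1_differentiable_on (- {0})"
    and density_bdd: "\<And>\<epsilon>. \<epsilon> > 0 \<Longrightarrow> bdd_above (\<nu> ` {x. \<bar>x\<bar> > \<epsilon>})"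
    and density_exp_bdd: "\<And>\<epsilon>. \<epsilon> > 0 \<Longrightarrow> bdd_above ((\<lambda>x. exp x * \<nu> x) ` {x. \<bar>x\<bar> > \<epsilon>})"
  shows
    "(\<sigma> = 0 \<and> (\<integral>\<^sup>+x\<in>{-1..1}. ennreal \<bar>x\<bar> \<partial>jump_measure \<nu>) < \<infinity> \<longrightarrow>
        b - (LBINT x:{-1..1}. x * \<nu> x)
          = b_star b \<sigma> \<nu> - (LBINT x:{-1..1}. x * nu_star \<nu> x))
     \<and> (\<forall>k>0. \<forall>s b1 b2. a1 k b1 s \<nu> = a1 k b2 s \<nu>)
     \<and> (\<exists>R :: real \<Rightarrow> (real \<Rightarrow> real) \<Rightarrow> real.
          (\<forall>y>0. \<forall>\<mu> b' s. R y \<mu> = d2 y b' s \<mu> - (- s\<^sup>2 * deriv \<mu> y + 2 * b' * \<mu> y)) \<and>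
          (\<forall>k>0. \<forall>b' s. a1 k b' s \<nu> =
             s\<^sup>2 / 2 * exp k * \<nu> k
             + exp k * \<nu> k * (LBINT x:{-1..1}. x * (exp x - 1) * \<nu> x)
             + (1 / 2) * (R k (nu_star \<nu>) - exp k * R k \<nu>)))
     \<and> (\<forall>k>0. \<forall>b' s. a1 k b' s \<nu> - a1 k b' 0 \<nu> = s\<^sup>2 / 2 * exp k * \<nu> k)
     \<and> (\<forall>k>0. \<forall>b' s. \<forall>t\<ge>0.
          (call_approx S0 t k b' s \<nu> - call_approx S0 t k b' 0 \<nu>) / S0
            = s\<^sup>2 * t\<^sup>2 / 2 * exp k * \<nu> k
          \<and> (s \<noteq> 0 \<and> t > 0 \<longrightarrow> call_approx S0 t k b' 0 \<nu> < call_approx S0 t k b' s \<nu>))"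
proof -
  \<comment> \<open>A point \<open>k > 0\<close> lies in the open set \<open>- {0}\<close>, where
    \<nu> is C1.\<close>
  have diff: "\<nu> differentiable at k" if "k > 0" for k
    using density_C1 that by (auto simp: C1_differentiable_on_eq)
  have a1: "a1 k b' s \<nu> = s\<^sup>2 / 2 * exp k * \<nu> k
      + exp k * \<nu> k * (LBINT x:{-1..1}. x * (exp x - 1) * \<nu> x)
      + (1 / 2) * (d2 k 0 0 (nu_star \<nu>) - exp k * d2 k 0 0 \<nu>)" if "k > 0" for k b' s
    by (rule a1_eq[OF diff[OF that]])
  have a1_diff: "a1 k b' s \<nu> - a1 k b' 0 \<nu> = s\<^sup>2 / 2 * exp k * \<nu> k" if "k > 0" for k b' s
    using a1[OF that, of b' s] a1[OF that, of b' 0] by simp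
  have call_diff: "call_approx S0 t k b' s \<nu> - call_approx S0 t k b' 0 \<nu>
      = S0 * (s\<^sup>2 * t\<^sup>2 / 2 * exp k * \<nu> k)" if "k > 0" for t k b' s
  proof -
    \<comment> \<open>The term of first order in \<open>t\<close> contains neither drift nor
      volatility and cancels.\<close>
    have "call_approx S0 t k b' s \<nu> - call_approx S0 t k b' 0 \<nu>
        = S0 * (t\<^sup>2 * (a1 k b' s \<nu> - a1 k b' 0 \<nu>))"
      by (simp add: call_approx_def algebra_simps)
    then show ?thesis
      by (simp add: a1_diff[OF that])
  qed
  have call_less: "call_approx S0 t k b' 0 \<nu> < call_approx S0 t k b' s \<nu>"
    if "k > 0" "s \<noteq> 0" "t > 0" for t k b' s
  proof -
    have "0 < S0 * (s\<^sup>2 * t\<^sup>2 / 2 * exp k * \<nu> k)"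
      using that S0_pos density_pos[of k] by simp
    then show ?thesis
      using call_diff[OF that(1), of t b' s] by linarith
  qed
  have drifts: "b - (LBINT x:{-1..1}. x * \<nu> x)
      = b_star b \<sigma> \<nu> - (LBINT x:{-1..1}. x * nu_star \<nu> x)"
    if "\<sigma> = 0" "(\<integral>\<^sup>+x\<in>{-1..1}. ennreal \<bar>x\<bar> \<partial>jump_measure \<nu>) < \<infinity>"
    using drift_coincide[OF C1_differentiable_on_borel_measurable[OF density_C1] _ that(2)]
      that(1) density_pos by (simp add: less_imp_le)
  have R: "d2 y 0 0 \<mu> = d2 y b' s \<mu> - (- s\<^sup>2 * deriv \<mu> y + 2 * b' * \<mu> y)" for y \<mu> b' s
    using d2_affine[of y b' s \<mu>] by simp
  show ?thesis
  proof (intro conjI)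
    show "\<exists>R :: real \<Rightarrow> (real \<Rightarrow> real) \<Rightarrow> real.
          (\<forall>y>0. \<forall>\<mu> b' s. R y \<mu> = d2 y b' s \<mu> - (- s\<^sup>2 * deriv \<mu> y + 2 * b' * \<mu> y)) \<and>
          (\<forall>k>0. \<forall>b' s. a1 k b' s \<nu> =
             s\<^sup>2 / 2 * exp k * \<nu> k
             + exp k * \<nu> k * (LBINT x:{-1..1}. x * (exp x - 1) * \<nu> x)
             + (1 / 2) * (R k (nu_star \<nu>) - exp k * R k \<nu>))"
      \<comment> \<open>Setting drift and volatility to zero removes the affine part of
        \<open>d2\<close> and leaves the witness.\<close>
      using R a1 by (intro exI[of _ "\<lambda>y \<mu>. d2 y 0 0 \<mu>"]) blast
    show "\<forall>k>0. \<forall>s b1 b2. a1 k b1 s \<nu> = a1 k b2 s \<nu>"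
      \<comment> \<open>The closed form on the right of \<open>a1\<close> does not contain the
        drift.\<close>
      by (simp add: a1)
  qed (use drifts a1_diff call_diff call_less S0_pos in auto)
qed

end
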